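(* Let $f_1,\dots,f_n\in\mathbb{R}[x,y]$ be square-independent polynomials. Assume that they have a common zero in $\mathbb{R}^2$ and that the $y$-leading coefficient of each $f_i$ is positive. Then $$p_2\big(\mathbb{R}[x,y,\sqrt{f_1},\dots,\sqrt{f_n}]\big)=\infty .$$
   Context: For a commutative ring $R$ with identity, the $2$-Pythagoras number $p_2(R)$ is the smallest positive integer $g$ such that every element of $R$ which is a (finite) sum of squares in $R$ is a sum of at most $g$ squares in $R$; if no such $g$ exists, $p_2(R)=\infty$. A finite sequence $f_1,\dots,f_n\in\mathbb{R}[x,y]$ is called square-independent if for every non-empty subset $S\subseteq\{1,\dots,n\}$ the product $f_S=\prod_{i\in S}f_i$ is not a square in $\mathbb{R}[x,y]$. For $f\in\mathbb{R}[x,y]$ with $d=\deg_y f$, let $\alpha x^b y^d$ be the monomial of $f$ with nonzero coefficient $\alpha$ and with $b$ largest possible among all monomials of $f$ having $y$-degree $d$. Then $\alpha$ is called the $y$-leading coefficient of $f$. The ring $\mathbb{R}[x,y,\sqrt{f_1},\dots,\sqrt{f_n}]$ is $\mathbb{R}[x,y,z_1,\dots,z_n]/(z_1^2-f_1,\dots,z_n^2-f_n)$, with $\sqrt{f_i}$ the class of $z_i$. *)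

theory Defs
  imports
    "HOL-Computational_Algebra.Polynomial"
    "HOL-Library.Poly_Mapping"
    "HOL-Library.Extended_Nat"
    "HOL-Algebra.QuotRing"
begin

section \<open>The 2-Pythagoras number of a commutative ring\<close>

definition is_sum_of_n_squares :: "('a, 'b) ring_scheme \<Rightarrow> nat \<Rightarrow> 'a \<Rightarrow> bool" where
  "is_sum_of_n_squares R k a \<longleftrightarrow>
     (\<exists>h \<in> {..<k} \<rightarrow> carrier R. a = (\<Oplus>\<^bsub>R\<^esub>i\<in>{..<k}. h i [^]\<^bsub>R\<^esub> (2::nat)))"

definition pythagoras_bound :: "('a, 'b) ring_scheme \<Rightarrow> nat \<Rightarrow> bool" where
  "pythagoras_bound R g \<longleftrightarrow>
     (\<forall>a \<in> carrier R. (\<exists>k. is_sum_of_n_squares R k a) \<longrightarrow> (\<exists>k\<le>g. is_sum_of_n_squares R k a))"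

definition pythagoras_number :: "('a, 'b) ring_scheme \<Rightarrow> enat" ("p\<^sub>2") where
  "p\<^sub>2 R = (if \<exists>g>0. pythagoras_bound R g
            then enat (LEAST g. g > 0 \<and> pythagoras_bound R g) else \<infinity>)"

section \<open>Polynomials in two real variables\<close>

text \<open>
  \<open>\<real>[x,y]\<close> is represented as \<open>\<real>[x][y]\<close>: the outer polynomial variable is \<open>y\<close>, the inner one is \<open>x\<close>.
\<close>

type_synonym real_poly_xy = "real poly poly"

definition eval_xy :: "real_poly_xy \<Rightarrow> real \<Rightarrow> real \<Rightarrow> real" where
  "eval_xy f a b = poly (poly f [:b:]) a"

text \<open>
  The coefficient of \<open>y ^ degree f\<close> in \<open>f\<close> is the element \<open>lead_coeff f\<close> of \<open>\<real>[x]\<close>, so the monomial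
  with maximal \<open>x\<close>-degree among those of maximal \<open>y\<close>-degree carries its leading coefficient
  (and the value is \<open>0\<close> for \<open>f = 0\<close>).
\<close>

definition y_lead_coeff :: "real_poly_xy \<Rightarrow> real" where
  "y_lead_coeff f = lead_coeff (lead_coeff f)"

definition square_independent :: "nat \<Rightarrow> (nat \<Rightarrow> real_poly_xy) \<Rightarrow> bool" where
  "square_independent n f \<longleftrightarrow>
     (\<forall>S \<subseteq> {1..n}. S \<noteq> {} \<longrightarrow> \<not> (\<exists>h. (\<Prod>i\<in>S. f i) = h ^ 2))"

section \<open>Adjoining square roots\<close>

text \<open>
  A polynomial in \<open>z\<^sub>1, z\<^sub>2, \<dots>\<close> over \<open>\<real>[x,y]\<close> is a finitely supported map from monomials to
  coefficients, a monomial being the finitely supported map \<open>i \<mapsto>\<close> exponent of \<open>z\<^sub>i\<close>.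
\<close>

type_synonym zpoly = "(nat \<Rightarrow>\<^sub>0 nat) \<Rightarrow>\<^sub>0 real_poly_xy"

definition zpoly_const :: "real_poly_xy \<Rightarrow> zpoly" where
  "zpoly_const f = Poly_Mapping.single 0 f"

definition zpoly_var :: "nat \<Rightarrow> zpoly" where
  "zpoly_var i = Poly_Mapping.single (Poly_Mapping.single i 1) 1"

definition zpoly_ring :: "nat \<Rightarrow> zpoly ring" where
  "zpoly_ring n =
     \<lparr>carrier = {p. \<forall>m \<in> Poly_Mapping.keys p. Poly_Mapping.keys m \<subseteq> {1..n}},
      mult = (*), one = 1, zero = 0, add = (+)\<rparr>"

definition sqrt_ideal :: "nat \<Rightarrow> (nat \<Rightarrow> real_poly_xy) \<Rightarrow> zpoly set" where
  "sqrt_ideal n f = Idl\<^bsub>zpoly_ring n\<^esub> ((\<lambda>i. zpoly_var i ^ 2 - zpoly_const (f i)) ` {1..n})"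

definition sqrt_ring :: "nat \<Rightarrow> (nat \<Rightarrow> real_poly_xy) \<Rightarrow> zpoly set ring" where
  "sqrt_ring n f = zpoly_ring n Quot sqrt_ideal n f"

lemma zpoly_carrier_mult:
  assumes "p \<in> carrier (zpoly_ring n)" "q \<in> carrier (zpoly_ring n)"
  shows "p * q \<in> carrier (zpoly_ring n)"
proof -
  have "Poly_Mapping.keys m \<subseteq> {1..n}" if m: "m \<in> Poly_Mapping.keys (p * q)" for m
  proof -
    obtain a b where ab:
      "m = a + b" "a \<in> Poly_Mapping.keys p" "b \<in> Poly_Mapping.keys q"
      using m Poly_Mapping.keys_mult[of p q] by blast
    then have "Poly_Mapping.keys a \<subseteq> {1..n}" "Poly_Mapping.keys b \<subseteq> {1..n}"
      using assms unfolding zpoly_ring_def partial_object.simps by blast+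
    then show ?thesis
      using Poly_Mapping.keys_add[of a b] unfolding ab(1) by blast
  qed
  then show ?thesis unfolding zpoly_ring_def partial_object.simps by blast
qed

lemma zpoly_carrier_add:
  assumes "p \<in> carrier (zpoly_ring n)" "q \<in> carrier (zpoly_ring n)"
  shows "p + q \<in> carrier (zpoly_ring n)"
  using assms Poly_Mapping.keys_add[of p q] unfolding zpoly_ring_def partial_object.simps by blast

lemma zpoly_ring_simps:
  "x \<otimes>\<^bsub>zpoly_ring n\<^esub> y = x * y" "x \<oplus>\<^bsub>zpoly_ring n\<^esub> y = x + y"
  "\<one>\<^bsub>zpoly_ring n\<^esub> = 1" "\<zero>\<^bsub>zpoly_ring n\<^esub> = 0"
  by (simp_all add: zpoly_ring_def)

lemma zpoly_carrier_0: "0 \<in> carrier (zpoly_ring n)"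
  and zpoly_carrier_1: "1 \<in> carrier (zpoly_ring n)"
  and zpoly_carrier_uminus: "p \<in> carrier (zpoly_ring n) \<Longrightarrow> - p \<in> carrier (zpoly_ring n)"
  by (simp_all add: zpoly_ring_def)

lemma cring_zpoly_ring: "cring (zpoly_ring n)"
proof (rule cringI)
  show "abelian_group (zpoly_ring n)"
  proof (rule abelian_groupI, unfold zpoly_ring_simps)
    fix p assume p: "p \<in> carrier (zpoly_ring n)"
    show "\<exists>q\<in>carrier (zpoly_ring n). q + p = 0"
      by (rule bexI[OF _ zpoly_carrier_uminus[OF p]]) simp
  qed (simp_all only: zpoly_carrier_add zpoly_carrier_0 ac_simps add_0_left add_0_right)
  show "Group.comm_monoid (zpoly_ring n)"
    by (rule comm_monoidI, unfold zpoly_ring_simps)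
      (simp_all only: zpoly_carrier_mult zpoly_carrier_1 ac_simps mult_1_left mult_1_right)
qed (simp only: zpoly_ring_simps distrib_right)

lemma zpoly_generators_carrier:
  "(\<lambda>i. zpoly_var i ^ 2 - zpoly_const (f i)) ` {1..n} \<subseteq> carrier (zpoly_ring n)"
proof clarify
  fix i assume i: "i \<in> {1..n}"
  have "zpoly_var i \<in> carrier (zpoly_ring n)"
    using i by (auto simp: zpoly_ring_def zpoly_var_def)
  then have "zpoly_var i ^ 2 \<in> carrier (zpoly_ring n)"
    by (simp add: power2_eq_square zpoly_carrier_mult)
  moreover have "- zpoly_const (f i) \<in> carrier (zpoly_ring n)"
    by (auto simp: zpoly_ring_def zpoly_const_def)
  ultimately have "zpoly_var i ^ 2 + - zpoly_const (f i) \<in> carrier (zpoly_ring n)"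
    by (rule zpoly_carrier_add)
  then show "zpoly_var i ^ 2 - zpoly_const (f i) \<in> carrier (zpoly_ring n)"
    by simp
qed

lemma ideal_sqrt_ideal: "ideal (sqrt_ideal n f) (zpoly_ring n)"
  unfolding sqrt_ideal_def
  by (intro ring.genideal_ideal cring.axioms(1) cring_zpoly_ring zpoly_generators_carrier)

lemma cring_sqrt_ring: "cring (sqrt_ring n f)"
  unfolding sqrt_ring_def
  by (intro ideal.quotient_is_cring ideal_sqrt_ideal cring_zpoly_ring)

end

theory Submission imports Defs begin

text \<open>
  Fix \<open>d\<close>, give \<open>x\<close> weight \<open>1\<close> and \<open>y\<close> a large weight \<open>M\<close>, and let
  \<open>q\<^sub>j = \<Prod>\<^bsub>s < M(d - j)\<^esub> (x - x\<^sub>s) \<cdot> \<Prod>\<^bsub>t < j\<^esub> (y - y\<^sub>t)\<close> for \<open>j \<le> d\<close>, all of weighted degree \<open>Md\<close>.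
  They span the polynomials of weighted degree at most \<open>Md\<close> that vanish at the points \<open>(x\<^sub>s, y\<^sub>t)\<close> with
  \<open>s < M(d - t)\<close>, and only \<open>0\<close> has smaller weighted degree and vanishes there.
  The positive \<open>y\<close>-leading coefficients allow all these points to be chosen where every \<open>f\<^sub>i\<close> is positive.

  If \<open>\<Sum>\<^sub>j q\<^sub>j\<^sup>2\<close> is a sum of \<open>K\<close> squares in the extended ring, comparing the components without square
  roots gives \<open>\<Sum>\<^sub>j q\<^sub>j\<^sup>2 = \<Sum>\<^sub>k \<Sum>\<^sub>S f\<^sub>S u\<^sub>k\<^sub>,\<^sub>S\<^sup>2\<close>. Every \<open>u\<^sub>k\<^sub>,\<^sub>S\<close> vanishes at the points. Along the curves \<open>y = c x\<^sup>M\<close>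
  with \<open>c > 0\<close> the leading terms on the right are positive and cannot cancel, which bounds the weighted degree
  of \<open>u\<^sub>k\<^sub>,\<^sub>S\<close> by \<open>Md\<close>, strictly if \<open>S \<noteq> \<emptyset>\<close> since then \<open>f\<^sub>S\<close> is not constant. So \<open>u\<^sub>k\<^sub>,\<^sub>S = 0\<close> for
  \<open>S \<noteq> \<emptyset>\<close>, and \<open>\<Sum>\<^sub>j q\<^sub>j\<^sup>2\<close> is a sum of \<open>K\<close> squares of real linear combinations of the \<open>q\<^sub>j\<close>. The products
  \<open>q\<^sub>i q\<^sub>j\<close> with \<open>i \<le> j\<close> are linearly independent, so the coefficient vectors form \<open>d + 1\<close> orthonormal
  vectors in \<open>\<real>\<^sup>K\<close> and \<open>K > d\<close>.
\<close>

section \<open>Orthonormal coefficients and Newton products\<close>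

text \<open>The squares of all entries sum to \<open>d + 1\<close> by columns, while Bessel's
  inequality bounds each of the \<open>K\<close> row sums by 1.\<close>

lemma orthonormal_columns_le:
  fixes c :: "nat \<Rightarrow> nat \<Rightarrow> real"
  assumes orth: "\<And>i j. i \<le> d \<Longrightarrow> j \<le> d \<Longrightarrow> (\<Sum>k<K. c k i * c k j) = (if i = j then 1 else 0)"
  shows "d < K"
proof -
  have bessel: "(\<Sum>i\<le>d. c k i * c k i) \<le> 1" if "k < K" for k
  proof -
    \<comment> \<open>\<open>?w\<close> is the orthogonal projection of the \<open>k\<close>-th unit
      vector onto the span of the columns. The squared length of the difference is nonnegative,
      which is Bessel's inequality.\<close>
    let ?w = "\<lambda>l. \<Sum>i\<le>d. c k i * c l i"
    have "(\<Sum>l<K. ?w l * ?w l) = (\<Sum>l<K. \<Sum>i\<le>d. \<Sum>j\<le>d. c k i * c k j * (c l i * c l j))"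
      by (simp add: sum_product mult_ac)
    also have "\<dots> = (\<Sum>i\<le>d. \<Sum>j\<le>d. \<Sum>l<K. c k i * c k j * (c l i * c l j))"
      by (subst sum.swap, intro sum.cong refl sum.swap)
    also have "\<dots> = (\<Sum>i\<le>d. \<Sum>j\<le>d. c k i * c k j * (if i = j then 1 else 0))"
      by (intro sum.cong refl) (simp add: orth flip: sum_distrib_left)
    also have "\<dots> = (\<Sum>i\<le>d. c k i * c k i)"
      by (simp add: if_distrib cong: if_cong)
    finally have w: "(\<Sum>l<K. ?w l * ?w l) = (\<Sum>i\<le>d. c k i * c k i)" .
    have "0 \<le> (\<Sum>l<K. ((if l = k then 1 else 0) - ?w l)\<^sup>2)"
      by (intro sum_nonneg) simp
    also have "\<dots> = (\<Sum>l<K. (if l = k then 1 - 2 * ?w l else 0) + ?w l * ?w l)"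
      by (intro sum.cong) (auto simp: power2_eq_square algebra_simps)
    also have "\<dots> = 1 - 2 * ?w k + (\<Sum>l<K. ?w l * ?w l)"
      using that by (simp add: sum.distrib)
    finally show ?thesis
      by (simp add: w)
  qed
  have "real (Suc d) = (\<Sum>i\<le>d. \<Sum>k<K. c k i * c k i)"
    by (simp add: orth)
  also have "\<dots> = (\<Sum>k<K. \<Sum>i\<le>d. c k i * c k i)"
    by (rule sum.swap)
  also have "\<dots> \<le> (\<Sum>k<K. 1)"
    by (intro sum_mono bessel) simp
  finally show ?thesis by simp
qed

section \<open>Linear independence of products of Newton polynomials\<close>

lemma const_poly_prod: "(\<Prod>t\<in>A. [:h t:]) = [:\<Prod>t\<in>A. h t :: 'a::comm_semiring_1:]"
  by (induction A rule: infinite_finite_induct) (simp_all add: one_pCons mult.commute)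

text \<open>The order of vanishing at successive y-nodes separates the products, so the rows of
  \<open>G\<close> are eliminated one at a time, and \<open>indep\<close> splits a row into its
  entries. Symmetry enters because the products for \<open>(i, j)\<close> and \<open>(j, i)\<close>
  coincide: the relation only sees \<open>G i j + G j i\<close>.\<close>

lemma newton_products_independent:
  fixes G :: "nat \<Rightarrow> nat \<Rightarrow> real" and \<alpha> :: "nat \<Rightarrow> real poly" and \<eta> :: "nat \<Rightarrow> real"
  assumes inj: "inj \<eta>"
    and indep: "\<And>c. (\<Sum>j\<le>d. smult (c j) (\<alpha> j)) = 0 \<Longrightarrow> \<forall>j\<le>d. c j = 0"
    and sym: "\<And>i j. G i j = G j i"
    and zero: "(\<Sum>i\<le>d. \<Sum>j\<le>d. smult (smult (G i j) (\<alpha> i * \<alpha> j))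
        ((\<Prod>t<i. [:[:-\<eta> t:], 1:]) * (\<Prod>t<j. [:[:-\<eta> t:], 1:]))) = 0"
    and "i \<le> d" "j \<le> d"
  shows "G i j = 0"
proof -
  define N where "N m j = (\<Prod>t=m..<j. [:[:-\<eta> t:], 1:])" for m j
  have nz: "\<alpha> m \<noteq> 0" if "m \<le> d" for m
  proof
    assume "\<alpha> m = 0"
    then have "(\<Sum>j\<le>d. smult (if j = m then 1 else 0) (\<alpha> j)) = 0"
      by (intro sum.neutral) auto
    from indep[OF this] that show False by auto
  qed
  have "\<forall>i j. i < m \<longrightarrow> i \<le> d \<longrightarrow> j \<le> d \<longrightarrow> G i j = 0" for m
  proof (induction m)
    case 0
    show ?case by simp
  next
    case (Suc m)
    have row: "G i j = 0" "G j i = 0" if "i < m" "i \<le> d" "j \<le> d" for i j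
      using Suc.IH that sym by metis+
    show ?case
    proof (cases "m \<le> d")
      case False
      with Suc.IH show ?thesis by auto
    next
      case True
      define g where "g i j = smult (G i j) (\<alpha> i * \<alpha> j)" for i j
      have g0: "g i j = 0" if "G i j = 0" for i j
        using that by (simp add: g_def)
      have split: "N 0 i = N 0 m * N m i" if "m \<le> i" for i
        using that unfolding N_def by (intro prod.atLeastLessThan_concat[symmetric]) auto
      \<comment> \<open>The surviving terms are divisible by \<open>(N 0 m)\<^sup>2\<close>. Cancelling it and setting \<open>y = \<eta> m\<close> isolates the
        diagonal entry \<open>G m m\<close>; cancelling one more factor \<open>y - \<eta> m\<close> isolates the rest of row \<open>m\<close>.\<close>
      have "(\<Sum>i\<le>d. \<Sum>j\<le>d. N 0 m * N 0 m * smult (g i j) (N m i * N m j)) =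
          (\<Sum>i\<le>d. \<Sum>j\<le>d. smult (g i j) (N 0 i * N 0 j))"
      proof (intro sum.cong refl)
        fix i j assume ij: "i \<in> {..d}" "j \<in> {..d}"
        consider "G i j = 0" | "m \<le> i" "m \<le> j"
          using row[of i j] row[of j i] ij by (metis atMost_iff linorder_not_le)
        then show "N 0 m * N 0 m * smult (g i j) (N m i * N m j) = smult (g i j) (N 0 i * N 0 j)"
          by cases (simp_all add: g0 split[of i] split[of j] mult.assoc mult.left_commute)
      qed
      also have "\<dots> = 0"
        using zero by (simp add: N_def atLeast0LessThan g_def)
      finally have "N 0 m * N 0 m * (\<Sum>i\<le>d. \<Sum>j\<le>d. smult (g i j) (N m i * N m j)) = 0"
        by (simp only: sum_distrib_left)
      moreover have "N 0 m \<noteq> 0"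
        by (simp add: N_def)
      ultimately have z: "(\<Sum>i\<le>d. \<Sum>j\<le>d. smult (g i j) (N m i * N m j)) = 0"
        by simp
      have ev: "poly (N m i) [:\<eta> m:] = (if i \<le> m then 1 else 0)" for i
        by (auto simp: N_def poly_prod)
      have "(\<Sum>i\<le>d. \<Sum>j\<le>d. g i j * ((if i \<le> m then 1 else 0) * (if j \<le> m then 1 else 0))) = 0"
        using arg_cong[OF z, of "\<lambda>p. poly p [:\<eta> m:]"] by (simp add: poly_sum ev)
      also have "(\<Sum>i\<le>d. \<Sum>j\<le>d. g i j * ((if i \<le> m then 1 else 0) * (if j \<le> m then 1 else 0)))
          = (\<Sum>i\<le>d. \<Sum>j\<le>d. if i = m then if j = m then g m m else 0 else 0)"
        by (intro sum.cong refl) (auto simp: row g0 nat_less_le)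
      also have "\<dots> = (\<Sum>i\<le>d. if i = m then g m m else 0)"
        using True by (intro sum.cong refl) auto
      also have "\<dots> = g m m"
        using True by simp
      finally have diag: "G m m = 0"
        using nz[OF True] by (simp add: g_def)
      define L where "L = [:[:-\<eta> m:], 1:]"
      have L: "L \<noteq> 0" "poly L [:\<eta> m:] = 0"
        by (simp_all add: L_def)
      \<comment> \<open>\<open>E i j\<close> is \<open>N m i * N m j\<close> divided by
        \<open>L\<close> when \<open>i\<close> and \<open>j\<close> are at least \<open>m\<close>
        and not both equal to \<open>m\<close>; for all other pairs \<open>g i j\<close> is already
        0.\<close>
      define E where "E i j = (if i = m then N (Suc m) j else if j = m then N (Suc m) i
          else L * N (Suc m) i * N (Suc m) j)" for i j
      have head: "N m i = L * N (Suc m) i" if "m < i" for i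
        using that unfolding N_def L_def by (simp add: prod.atLeast_Suc_lessThan)
      have Nmm: "N m m = 1"
        by (simp add: N_def)
      have "(\<Sum>i\<le>d. \<Sum>j\<le>d. L * smult (g i j) (E i j)) =
          (\<Sum>i\<le>d. \<Sum>j\<le>d. smult (g i j) (N m i * N m j))"
      proof (intro sum.cong refl)
        fix i j assume ij: "i \<in> {..d}" "j \<in> {..d}"
        consider "G i j = 0" | "i = m" "j > m" | "i > m" "j = m" | "i > m" "j > m"
          using row[of i j] row[of j i] diag ij by (metis atMost_iff linorder_neqE_nat)
        then show "L * smult (g i j) (E i j) = smult (g i j) (N m i * N m j)"
          by cases (simp_all add: g0 E_def head Nmm mult_ac)
      qed
      then have "L * (\<Sum>i\<le>d. \<Sum>j\<le>d. smult (g i j) (E i j)) = 0"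
        using z by (simp only: sum_distrib_left)
      then have "(\<Sum>i\<le>d. \<Sum>j\<le>d. smult (g i j) (E i j)) = 0"
        using L(1) by simp
      from arg_cong[OF this, of "\<lambda>p. poly p [:\<eta> m:]"]
      have "(\<Sum>i\<le>d. \<Sum>j\<le>d. g i j * poly (E i j) [:\<eta> m:]) = 0"
        by (simp add: poly_sum)
      also have "(\<Sum>i\<le>d. \<Sum>j\<le>d. g i j * poly (E i j) [:\<eta> m:]) =
          (\<Sum>i\<le>d. \<Sum>j\<le>d. (if i = m then g m j * poly (N (Suc m) j) [:\<eta> m:] else 0) +
             (if j = m then g m i * poly (N (Suc m) i) [:\<eta> m:] else 0))"
      proof (intro sum.cong refl)
        fix i j
        have gi: "g i m = g m i"
          by (simp only: g_def sym[of i m] mult.commute)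
        show "g i j * poly (E i j) [:\<eta> m:] =
            (if i = m then g m j * poly (N (Suc m) j) [:\<eta> m:] else 0) +
            (if j = m then g m i * poly (N (Suc m) i) [:\<eta> m:] else 0)"
          by (cases "i = m"; cases "j = m") (simp_all add: E_def L(2) g0[OF diag] gi)
      qed
      also have "\<dots> = 2 * (\<Sum>j\<le>d. g m j * poly (N (Suc m) j) [:\<eta> m:])"
      proof -
        have "(\<Sum>i\<le>d. \<Sum>j\<le>d. if i = m then h j else 0) = sum h {..d}" for h :: "nat \<Rightarrow> real poly"
          using True by (subst sum.swap) simp
        moreover have "(\<Sum>i\<le>d. \<Sum>j\<le>d. if j = m then h i else 0) = sum h {..d}" for h :: "nat \<Rightarrow> real poly"
          using True by simp
        ultimately show ?thesis by (simp add: sum.distrib)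
      qed
      \<comment> \<open>At \<open>\<eta> m\<close> every \<open>N (Suc m) j\<close> takes a nonzero
        constant value, so what remains is a real linear relation among the
        \<open>\<alpha> j\<close>.\<close>
      also have "\<dots> = 2 * \<alpha> m * (\<Sum>j\<le>d. smult (G m j * (\<Prod>t=Suc m..<j. \<eta> m - \<eta> t)) (\<alpha> j))"
      proof -
        have "poly (N (Suc m) j) [:\<eta> m:] = [:\<Prod>t=Suc m..<j. \<eta> m - \<eta> t:]" for j
          by (simp add: N_def poly_prod const_poly_prod)
        then show ?thesis
          by (simp add: g_def sum_distrib_left mult_ac)
      qed
      finally have "(\<Sum>j\<le>d. smult (G m j * (\<Prod>t=Suc m..<j. \<eta> m - \<eta> t)) (\<alpha> j)) = 0"
        using nz[OF True] by simp
      from indep[OF this] have "G m j * (\<Prod>t=Suc m..<j. \<eta> m - \<eta> t) = 0" if "j \<le> d" for j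
        using that by blast
      moreover have "(\<Prod>t=Suc m..<j. \<eta> m - \<eta> t) \<noteq> 0" for j
        by (auto dest: injD[OF inj])
      ultimately have "G m j = 0" if "j \<le> d" for j
        using that by (metis mult_eq_0_iff)
      with Suc.IH show ?thesis
        by (auto simp: less_Suc_eq)
    qed
  qed
  from this[of "Suc i"] show ?thesis
    using assms by simp
qed

section \<open>Interpolation on a triangular grid\<close>

lemma prod_linear_dvd:
  fixes p :: "'a::idom poly"
  assumes "inj_on X {..<k::nat}" "\<And>s. s < k \<Longrightarrow> poly p (X s) = 0"
  shows "(\<Prod>s<k. [:-X s, 1:]) dvd p"
  using assms
proof (induction k arbitrary: p)
  case 0
  show ?case by simp
next
  case (Suc k)
  from Suc.prems(2)[of k] obtain q where q: "p = [:-X k, 1:] * q"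
    by (auto simp: poly_eq_0_iff_dvd)
  have "poly q (X s) = 0" if "s < k" for s
  proof -
    have "X s \<noteq> X k"
      using Suc.prems(1) that by (auto simp: inj_on_def)
    then show ?thesis
      using Suc.prems(2)[of s] that by (auto simp: q)
  qed
  then have "(\<Prod>s<k. [:-X s, 1:]) dvd q"
    using Suc.prems(1) by (intro Suc.IH) (auto simp: inj_on_def)
  then show ?case
    by (simp only: q prod.lessThan_Suc mult.commute[of _ "[:-X k, 1:]"] mult_dvd_mono dvd_refl)
qed

lemma degree_prod_linear: "degree (\<Prod>s\<in>A. [:-X s, 1::'a::idom:]) = card A"
  by (subst degree_prod_sum_eq) simp_all

lemma vanishing_at_degree_many_points:
  fixes p :: "'a::idom poly"
  assumes "inj_on X {..<k::nat}" "\<And>s. s < k \<Longrightarrow> poly p (X s) = 0" "degree p \<le> k"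
  obtains c where "p = smult c (\<Prod>s<k. [:-X s, 1:])" "degree p < k \<Longrightarrow> p = 0"
proof -
  obtain q where q: "p = (\<Prod>s<k. [:-X s, 1:]) * q"
    using prod_linear_dvd[OF assms(1,2)] by auto
  have deg: "degree p = k + degree q" if "q \<noteq> 0"
    using that by (simp add: q degree_mult_eq degree_prod_linear)
  then have "degree q = 0"
    using assms(3) by (cases "q = 0") auto
  then obtain c where "q = [:c:]"
    by (rule degree_eq_zeroE)
  then show thesis
    using that[of c] deg q by (cases "q = 0") auto
qed

text \<open>This is \<open>q\<^sub>j\<close> with arbitrary nodes, a bivariate Newton basis. Only
  \<open>j \<le> d\<close> is meant: beyond that the truncated subtraction makes the factor in x
  equal to 1 and the weighted degree is no longer \<open>M * d\<close>.\<close>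

definition newton_term :: "nat \<Rightarrow> (nat \<Rightarrow> 'a) \<Rightarrow> (nat \<Rightarrow> 'a) \<Rightarrow> nat \<Rightarrow> nat \<Rightarrow> 'a::comm_ring_1 poly poly" where
  "newton_term M X \<eta> d j =
     smult (\<Prod>s<M * (d - j). [:-X s, 1:]) (\<Prod>t<j. [:[:-\<eta> t:], 1:])"

text \<open>Division by \<open>y - c\<close> with \<open>c\<close> constant, a polynomial of weight
  \<open>M\<close>, lowers the weighted degree by \<open>M\<close>. The bound
  \<open>D < a + M * Suc j\<close> expresses this without the truncated difference
  \<open>D - M\<close>.\<close>

lemma weight_synthetic_div:
  fixes u :: "'a::comm_ring_1 poly poly"
  assumes "\<And>a j. D < a + M * j \<Longrightarrow> coeff (coeff u j) a = 0" "D < a + M * Suc j"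
  shows "coeff (coeff (synthetic_div u [:c:]) j) a = 0"
  using assms
proof (induction u arbitrary: D j)
  case 0
  then show ?case by simp
next
  case (pCons p u)
  have u: "coeff (coeff u i) b = 0" if "D < b + M * Suc i" for b i
    using pCons.prems(1)[of b "Suc i"] that by simp
  show ?case
  proof (cases j)
    case 0
    have "coeff (poly u [:c:]) a = (\<Sum>i\<le>degree u. coeff (coeff u i) a * c ^ i)"
      by (simp add: poly_altdef coeff_sum poly_const_pow mult.commute[of _ "[:_:]"] mult.commute)
    also have "\<dots> = 0"
      using pCons.prems(2) 0 by (intro sum.neutral) (auto simp: u)
    finally show ?thesis by (simp add: 0)
  next
    case (Suc i)
    have "coeff (coeff (synthetic_div u [:c:]) i) a = 0"
    proof (cases "M \<le> D")
      case True
      with pCons.prems(2) Suc show ?thesis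
        by (intro pCons.IH[of "D - M"] u) auto
    next
      case False
      have "coeff (coeff u i) b = 0" for i b
        using False by (intro u) simp
      then have "u = 0"
        by (intro poly_eqI) simp
      then show ?thesis by simp
    qed
    then show ?thesis by (simp add: Suc)
  qed
qed

text \<open>Induction on \<open>d\<close>. The restriction to the line \<open>y = \<eta> 0\<close>
  has degree at most \<open>M * d\<close> and that many zeros, so it is a scalar multiple of the
  node polynomial; the quotient by \<open>y - \<eta> 0\<close> poses the same problem for
  \<open>d - 1\<close> and the shifted nodes. Spanning and uniqueness share this division and are
  therefore proved together.\<close>

lemma newton_interpolation:
  fixes u :: "'a::idom poly poly"
  assumes "inj X" and "M > 0" and "inj \<eta>"
    and "\<And>a j. M * d < a + M * j \<Longrightarrow> coeff (coeff u j) a = 0"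
    and "\<And>s t. t < d \<Longrightarrow> s < M * (d - t) \<Longrightarrow> poly (poly u [:\<eta> t:]) (X s) = 0"
  shows "(\<exists>c. u = (\<Sum>j\<le>d. smult [:c j:] (newton_term M X \<eta> d j))) \<and>
    ((\<forall>a j. M * d \<le> a + M * j \<longrightarrow> coeff (coeff u j) a = 0) \<longrightarrow> u = 0)"
  using assms(3-5)
proof (induction d arbitrary: u \<eta>)
  case 0
  let ?c = "coeff (coeff u 0) 0"
  have "coeff (coeff u j) a = coeff (coeff [:[:?c:]:] j) a" for a j
    using 0(2)[of a j] \<open>M > 0\<close> by (cases a; cases j) auto
  then have "u = [:[:?c:]:]"
    by (intro poly_eqI) blast
  also have "\<dots> = (\<Sum>j\<le>0. smult [:?c:] (newton_term M X \<eta> 0 j))"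
    by (simp add: newton_term_def)
  finally have "\<exists>c. u = (\<Sum>j\<le>0. smult [:c j:] (newton_term M X \<eta> 0 j))"
    by (rule exI[of _ "\<lambda>_. ?c"])
  moreover have "u = 0" if "\<forall>a j. M * 0 \<le> a + M * j \<longrightarrow> coeff (coeff u j) a = 0"
    using that by (intro poly_eqI) simp
  ultimately show ?case
    by blast
next
  case (Suc d)
  let ?v = "synthetic_div u [:\<eta> 0:]" and ?L = "[:[:-\<eta> 0:], 1:]" and ?A = "\<Prod>s<M * Suc d. [:-X s, 1:]"
  have u: "u = ?L * ?v + [:poly u [:\<eta> 0:]:]"
    using synthetic_div_correct'[of "[:\<eta> 0:]" u] by simp
  have coeff0: "coeff (poly u [:\<eta> 0:]) a = 0" if "\<And>j. coeff (coeff u j) a = 0" for a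
    by (simp add: poly_altdef coeff_sum poly_const_pow mult.commute[of _ "[:_:]"] that)
  have "degree (poly u [:\<eta> 0:]) \<le> M * Suc d"
    by (intro degree_le allI impI coeff0 Suc.prems(2)) auto
  moreover have "poly (poly u [:\<eta> 0:]) (X s) = 0" if "s < M * Suc d" for s
    using Suc.prems(3)[of 0 s] that by simp
  ultimately obtain c0 where c0: "poly u [:\<eta> 0:] = smult c0 ?A"
    "degree (poly u [:\<eta> 0:]) < M * Suc d \<Longrightarrow> poly u [:\<eta> 0:] = 0"
    using vanishing_at_degree_many_points[of X "M * Suc d" "poly u [:\<eta> 0:]"] \<open>inj X\<close>
    by (metis inj_on_subset subset_UNIV)
  have weight: "coeff (coeff ?v j) a = 0" if "M * d < a + M * j" for a j
    using Suc.prems(2) that by (intro weight_synthetic_div[of "M * Suc d" M]) auto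
  have vanish: "poly (poly ?v [:\<eta> (Suc t):]) (X s) = 0" if "t < d" "s < M * (d - t)" for s t
  proof -
    \<comment> \<open>The rows of the grid shrink, so every abscissa of row \<open>Suc t\<close>
      also occurs in row 0, where the remainder vanishes.\<close>
    have "poly (poly u [:\<eta> 0:]) (X s) = 0"
      using that mult_le_mono2[of "d - t" "Suc d" M] by (intro Suc.prems(3)) (simp_all add: le_SucI)
    moreover have "poly (poly u [:\<eta> (Suc t):]) (X s) = 0"
      using that by (intro Suc.prems(3)) auto
    moreover have "poly (poly u [:\<eta> (Suc t):]) (X s) =
        (\<eta> (Suc t) - \<eta> 0) * poly (poly ?v [:\<eta> (Suc t):]) (X s) + poly (poly u [:\<eta> 0:]) (X s)"
      using arg_cong[OF u, of "\<lambda>p. poly (poly p [:\<eta> (Suc t):]) (X s)"] by (simp add: algebra_simps)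
    ultimately have "(\<eta> (Suc t) - \<eta> 0) * poly (poly ?v [:\<eta> (Suc t):]) (X s) = 0"
      by simp
    then show ?thesis
      using \<open>inj \<eta>\<close> by (auto dest: injD)
  qed
  have "inj (\<lambda>t. \<eta> (Suc t))"
    using \<open>inj \<eta>\<close> by (auto simp: inj_def)
  note IH = Suc.IH[OF this weight vanish]
  obtain c where c: "?v = (\<Sum>j\<le>d. smult [:c j:] (newton_term M X (\<lambda>t. \<eta> (Suc t)) d j))"
    using IH by blast
  have shift: "?L * newton_term M X (\<lambda>t. \<eta> (Suc t)) d j = newton_term M X \<eta> (Suc d) (Suc j)" for j
    unfolding newton_term_def by (simp only: mult_smult_right prod.lessThan_Suc_shift diff_Suc_Suc comp_def)
  have "u = smult [:c0:] (newton_term M X \<eta> (Suc d) 0) +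
      (\<Sum>j\<le>d. smult [:c j:] (newton_term M X \<eta> (Suc d) (Suc j)))"
  proof -
    have "?L * ?v = (\<Sum>j\<le>d. smult [:c j:] (newton_term M X \<eta> (Suc d) (Suc j)))"
      by (simp only: c sum_distrib_left mult_smult_right shift)
    moreover have "[:smult c0 ?A:] = smult [:c0:] (newton_term M X \<eta> (Suc d) 0)"
      by (simp add: newton_term_def)
    ultimately show ?thesis
      using u c0(1) by (metis add.commute)
  qed
  also have "\<dots> = (\<Sum>j\<le>Suc d. smult [:case j of 0 \<Rightarrow> c0 | Suc i \<Rightarrow> c i:] (newton_term M X \<eta> (Suc d) j))"
    by (simp only: sum.atMost_Suc_shift nat.case)
  finally have span: "\<exists>c. u = (\<Sum>j\<le>Suc d. smult [:c j:] (newton_term M X \<eta> (Suc d) j))"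
    by (rule exI[of _ "\<lambda>j. case j of 0 \<Rightarrow> c0 | Suc i \<Rightarrow> c i"])
  have "u = 0" if strict: "\<And>a j. M * Suc d \<le> a + M * j \<Longrightarrow> coeff (coeff u j) a = 0"
  proof -
    have "degree (poly u [:\<eta> 0:]) \<le> M * Suc d - 1"
      by (intro degree_le allI impI coeff0 strict) auto
    then have "degree (poly u [:\<eta> 0:]) < M * Suc d"
      using \<open>M > 0\<close> by (simp add: le_less_trans)
    then have "poly u [:\<eta> 0:] = 0"
      by (rule c0(2))
    moreover have "?v = 0"
    proof -
      \<comment> \<open>Weighted degree below \<open>M * Suc d\<close> is weighted degree at most
        \<open>M * Suc d - 1\<close>; the subtraction is exact since \<open>M > 0\<close>.\<close>
      have "coeff (coeff ?v j) a = 0" if "M * d \<le> a + M * j" for a j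
        using strict that \<open>M > 0\<close>
        by (intro weight_synthetic_div[of "M * Suc d - 1" M]) (auto simp: add.assoc)
      with IH show ?thesis by blast
    qed
    ultimately show ?thesis
      using u by simp
  qed
  with span show ?case by blast
qed

section \<open>Weighted degrees along curves\<close>

lemma coeff_poly_monom:
  fixes u :: "'a::comm_ring_1 poly poly"
  shows "coeff (poly u (monom c M)) w =
    (\<Sum>i\<le>degree u. if w < M * i then 0 else coeff (coeff u i) (w - M * i) * c ^ i)"
proof -
  have "coeff (p * monom a k) w = (if w < k then 0 else coeff p (w - k) * a)" for p and a :: 'a and k
    by (simp add: mult.commute[of p] coeff_monom_mult mult.commute[of a])
  then show ?thesis
    by (simp add: poly_altdef coeff_sum monom_power)
qed

text \<open>On the curve \<open>y = c x^M\<close> all monomials of weight \<open>w\<close> merge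
  into \<open>x^w\<close>. The resulting coefficient is a polynomial in \<open>c\<close> that keeps
  them apart by their y-degree, and it is zero once it vanishes for all positive
  \<open>c\<close>.\<close>

lemma coeff_eq_0_if_poly_monom:
  fixes u :: "real poly poly"
  assumes "\<And>c. c > 0 \<Longrightarrow> coeff (poly u (monom c M)) (a + M * j) = 0"
  shows "coeff (coeff u j) a = 0"
proof -
  let ?w = "a + M * j"
  define P where
    "P = (\<Sum>i\<le>degree u. monom (if ?w < M * i then 0 else coeff (coeff u i) (?w - M * i)) i)"
  have "poly P c = coeff (poly u (monom c M)) ?w" for c
    unfolding P_def coeff_poly_monom poly_sum poly_monom by (intro sum.cong) auto
  then have "{0<..} \<subseteq> {c. poly P c = 0}"
    using assms by auto
  then have "infinite {c. poly P c = 0}"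
    using infinite_Ioi finite_subset by blast
  then have "P = 0"
    using poly_roots_finite by blast
  then have "coeff P j = 0" by simp
  then show ?thesis
    by (cases "j \<le> degree u") (auto simp: P_def coeff_sum coeff_eq_0)
qed

text \<open>Once \<open>M\<close> exceeds the x-degrees of all coefficients, the y-degree decides
  which monomial dominates on the curve, so the leading term comes from the monomial that defines
  the y-leading coefficient.\<close>

lemma lead_coeff_poly_monom:
  fixes f :: "'a::idom poly poly"
  obtains C where "\<And>M c. M > C \<Longrightarrow> c \<noteq> 0 \<Longrightarrow>
    degree (poly f (monom c M)) = M * degree f + degree (lead_coeff f) \<and>
    lead_coeff (poly f (monom c M)) = lead_coeff (lead_coeff f) * c ^ degree f"
proof (cases "f = 0")
  case True
  then show thesis by (intro that[of 0]) auto
next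
  case False
  \<comment> \<open>The sum serves as a crude upper bound for the maximum of the x-degrees.\<close>
  define C where "C = (\<Sum>i\<le>degree f. degree (coeff f i))"
  have C: "degree (coeff f i) \<le> C" if "i \<le> degree f" for i
    unfolding C_def using that by (intro member_le_sum) auto
  show thesis
  proof (rule that[of C])
    fix M and c :: 'a
    assume M: "M > C" and c: "c \<noteq> 0"
    let ?e = "M * degree f + degree (lead_coeff f)"
    have lower: "coeff (coeff f i) (w - M * i) = 0" if "i < degree f" "?e \<le> w" for i w
    proof (rule coeff_eq_0)
      have "M * Suc i \<le> M * degree f"
        using that by (intro mult_le_mono2) auto
      then show "degree (coeff f i) < w - M * i"
        using that C[of i] M by simp
    qed
    have "coeff (poly f (monom c M)) w =
        (\<Sum>i\<le>degree f. if i = degree f then coeff (lead_coeff f) (w - M * degree f) * c ^ degree f else 0)"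
      if "?e \<le> w" for w
      unfolding coeff_poly_monom
    proof (intro sum.cong refl)
      fix i assume "i \<in> {..degree f}"
      then show "(if w < M * i then 0 else coeff (coeff f i) (w - M * i) * c ^ i) =
        (if i = degree f then coeff (lead_coeff f) (w - M * degree f) * c ^ degree f else 0)"
        using lower[of i w] that by (cases "i = degree f") auto
    qed
    then have top: "coeff (poly f (monom c M)) w = coeff (lead_coeff f) (w - M * degree f) * c ^ degree f"
      if "?e \<le> w" for w
      using that by simp
    have "degree (poly f (monom c M)) \<le> ?e"
      by (intro degree_le allI impI) (simp add: top coeff_eq_0)
    moreover have "coeff (poly f (monom c M)) ?e \<noteq> 0"
      using c False by (simp add: top)
    ultimately have "degree (poly f (monom c M)) = ?e"
      by (meson le_antisym le_degree)
    then show "degree (poly f (monom c M)) = ?e \<and>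
      lead_coeff (poly f (monom c M)) = lead_coeff (lead_coeff f) * c ^ degree f"
      by (simp add: top)
  qed
qed

text \<open>Leading terms of equal degree add up without cancelling. Nonnegativity instead of
  positivity admits summands that are 0.\<close>

lemma degree_le_degree_sum:
  fixes p :: "'b \<Rightarrow> 'a::linordered_idom poly"
  assumes "finite A" "\<And>a. a \<in> A \<Longrightarrow> lead_coeff (p a) \<ge> 0" "a \<in> A"
  shows "degree (p a) \<le> degree (sum p A)"
proof -
  have add: "lead_coeff (p + q) \<ge> 0 \<and> degree (p + q) = max (degree p) (degree q)"
    if nonneg: "lead_coeff p \<ge> 0" "lead_coeff q \<ge> 0" for p q :: "'a poly"
  proof (cases "degree p" "degree q" rule: linorder_cases)
    case less
    then show ?thesis
      using nonneg by (simp add: degree_add_eq_right coeff_eq_0)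
  next
    case greater
    then show ?thesis
      using nonneg by (simp add: degree_add_eq_left coeff_eq_0)
  next
    case equal
    show ?thesis
    proof (cases "p = 0 \<or> q = 0")
      case True
      then show ?thesis using nonneg by auto
    next
      case False
      then have "lead_coeff p > 0" "lead_coeff q > 0"
        using nonneg by (simp_all add: less_le)
      then have "coeff (p + q) (degree q) > 0"
        using equal by simp
      moreover from this have "degree q \<le> degree (p + q)"
        by (intro le_degree) simp
      moreover have "degree (p + q) \<le> degree q"
        using degree_add_le[of p "degree q" q] equal by simp
      ultimately show ?thesis
        using equal by simp
    qed
  qed
  have "lead_coeff (sum p A) \<ge> 0 \<and> (\<forall>a\<in>A. degree (p a) \<le> degree (sum p A))"
    using assms(1,2)
  proof (induction A)
    case (insert b A)
    then show ?case
      using add[of "p b" "sum p A"] by auto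
  qed simp
  with assms(3) show ?thesis by blast
qed

section \<open>Positivity for large arguments and independence by degree\<close>

lemma eventually_poly_pos:
  fixes p :: "real poly"
  assumes "lead_coeff p > 0"
  shows "eventually (\<lambda>x. poly p x > 0) at_top"
proof -
  obtain n where "\<forall>x\<ge>n. poly p x \<ge> lead_coeff p"
    using poly_pinfty_gt_lc[OF assms] by blast
  with assms show ?thesis
    by (auto simp: eventually_at_top_linorder intro: less_le_trans)
qed

text \<open>For large \<open>x\<close> the coefficient \<open>lead_coeff f\<close> is positive at
  \<open>x\<close>, so specialising \<open>x\<close> keeps the y-degree and leaves a univariate
  polynomial with positive leading coefficient. How large \<open>y\<close> must be depends on
  \<open>x\<close>, hence the nested quantifiers.\<close>

lemma eventually_eval_pos:
  fixes f :: "real poly poly"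
  assumes "lead_coeff (lead_coeff f) > 0"
  shows "eventually (\<lambda>x. eventually (\<lambda>y. poly (poly f [:y:]) x > 0) at_top) at_top"
  using eventually_poly_pos[OF assms]
proof eventually_elim
  case (elim x)
  define p where "p = map_poly (\<lambda>c. poly c x) f"
  have coeff: "coeff p i = poly (coeff f i) x" for i
    by (simp add: p_def coeff_map_poly)
  have "degree p \<le> degree f"
    by (intro degree_le allI impI) (simp add: coeff coeff_eq_0)
  moreover have "degree f \<le> degree p"
    using elim by (intro le_degree) (simp add: coeff)
  ultimately have "lead_coeff p > 0"
    using elim by (simp add: coeff)
  moreover have "poly p y = poly (poly f [:y:]) x" for y
    unfolding p_def by (induction f) (auto simp: map_poly_pCons)
  ultimately show ?case
    using eventually_poly_pos[of p] by simp
qed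

text \<open>The degrees decrease with the index. At the degree of \<open>\<alpha> j\<close>, earlier
  terms are gone by induction and later ones have too small a degree.\<close>

lemma distinct_degrees_independent:
  fixes \<alpha> :: "nat \<Rightarrow> 'a::idom poly"
  assumes "(\<Sum>j\<le>d. smult (c j) (\<alpha> j)) = 0"
    and "\<And>i j. i < j \<Longrightarrow> j \<le> d \<Longrightarrow> degree (\<alpha> j) < degree (\<alpha> i)"
    and "\<And>j. j \<le> d \<Longrightarrow> \<alpha> j \<noteq> 0"
    and "j \<le> d"
  shows "c j = 0"
  using \<open>j \<le> d\<close>
proof (induction j rule: less_induct)
  case (less j)
  have "coeff (smult (c i) (\<alpha> i)) (degree (\<alpha> j)) = (if i = j then c j * lead_coeff (\<alpha> j) else 0)"
    if "i \<le> d" for i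
    using less assms(2)[of j i] that by (cases i j rule: linorder_cases) (auto simp: coeff_eq_0)
  then have "coeff (\<Sum>i\<le>d. smult (c i) (\<alpha> i)) (degree (\<alpha> j)) =
      (\<Sum>i\<le>d. if i = j then c j * lead_coeff (\<alpha> j) else 0)"
    unfolding coeff_sum by (intro sum.cong) auto
  also have "\<dots> = c j * lead_coeff (\<alpha> j)"
    using less.prems by simp
  finally show ?case
    using assms(1,3) less.prems by simp
qed

section \<open>A sum of squares that needs many squares\<close>

text \<open>The bound equals \<open>M * d\<close> for \<open>j \<le> d\<close>; the split form is
  correct for every \<open>j\<close>.\<close>

lemma degree_newton_term_poly_monom:
  fixes X \<eta> :: "nat \<Rightarrow> 'a::idom"
  shows "degree (poly (newton_term M X \<eta> d j) (monom c M)) \<le> M * (d - j) + M * j"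
proof -
  have "degree (\<Prod>t<j. [:-\<eta> t:] + monom c M) \<le> (\<Sum>t<j. degree ([:-\<eta> t:] + monom c M))"
    using degree_prod_sum_le[of "{..<j}" "\<lambda>t. [:-\<eta> t:] + monom c M"] by (simp add: comp_def)
  also have "\<dots> \<le> (\<Sum>t<j. M)"
    by (intro sum_mono degree_add_le) (simp_all add: degree_monom_le)
  finally have "degree (\<Prod>t<j. [:-\<eta> t:] + monom c M) \<le> M * j"
    by (simp add: mult.commute)
  moreover have "poly (newton_term M X \<eta> d j) (monom c M) =
      (\<Prod>s<M * (d - j). [:-X s, 1:]) * (\<Prod>t<j. [:-\<eta> t:] + monom c M)"
    by (simp add: newton_term_def poly_prod)
  ultimately show ?thesis
    using degree_mult_le[of "\<Prod>s<M * (d - j). [:-X s, 1:]" "\<Prod>t<j. [:-\<eta> t:] + monom c M"]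
    by (simp add: degree_prod_linear)
qed

text \<open>The factor in y kills the rows \<open>t < j\<close>. In the other rows
  \<open>d - t \<le> d - j\<close>, so the factor in x contains every abscissa of the row.\<close>

lemma newton_term_vanishes:
  assumes "t < d" "s < M * (d - t)"
  shows "poly (poly (newton_term M X \<eta> d j) [:\<eta> t:]) (X s) = 0"
proof (cases "t < j")
  case True
  then have "(\<Prod>i<j. poly [:[:-\<eta> i:], 1:] [:\<eta> t:]) = 0"
    by (intro prod_zero) auto
  then show ?thesis
    by (simp add: newton_term_def poly_prod)
next
  case False
  then have "M * (d - t) \<le> M * (d - j)"
    by (intro mult_le_mono2) simp
  with assms(2) have "s < M * (d - j)"
    by (rule less_le_trans)
  then have "(\<Prod>i<M * (d - j). poly [:-X i, 1:] (X s)) = 0"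
    by (intro prod_zero bexI[of _ s]) auto
  then show ?thesis
    by (simp add: newton_term_def poly_prod)
qed

text \<open>Both sides are quadratic forms in the Newton terms. By independence of their products
  the Gram matrix of the columns of \<open>c\<close> is the identity; \<open>G\<close> is the
  difference of these two matrices. The factors in x are independent because their degrees
  \<open>M * (d - j)\<close> are distinct.\<close>

lemma sum_squares_newton_terms:
  fixes c :: "nat \<Rightarrow> nat \<Rightarrow> real" and X \<eta> :: "nat \<Rightarrow> real"
  assumes "M > 0" "inj \<eta>"
    and eq: "(\<Sum>j\<le>d. (newton_term M X \<eta> d j)\<^sup>2) =
      (\<Sum>k<K. (\<Sum>j\<le>d. smult [:c k j:] (newton_term M X \<eta> d j))\<^sup>2)"
  shows "d < K"
proof (rule orthonormal_columns_le)
  define \<alpha> where "\<alpha> j = (\<Prod>s<M * (d - j). [:-X s, 1:])" for j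
  define B where "B j = (\<Prod>t<j. [:[:-\<eta> t:], 1:])" for j
  define G where "G i j = (\<Sum>k<K. c k i * c k j) - (if i = j then 1 else 0)" for i j
  have q: "newton_term M X \<eta> d j = smult (\<alpha> j) (B j)" for j
    by (simp add: newton_term_def \<alpha>_def B_def)
  define Q where "Q i j = smult (\<alpha> i * \<alpha> j) (B i * B j)" for i j
  have "(\<Sum>k<K. (\<Sum>j\<le>d. smult [:c k j:] (newton_term M X \<eta> d j))\<^sup>2) =
      (\<Sum>k<K. \<Sum>i\<le>d. \<Sum>j\<le>d. smult [:c k i * c k j:] (Q i j))"
    unfolding power2_eq_square sum_product
    by (intro sum.cong refl) (simp add: q Q_def mult_ac)
  also have "\<dots> = (\<Sum>i\<le>d. \<Sum>j\<le>d. \<Sum>k<K. smult [:c k i * c k j:] (Q i j))"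
    by (subst sum.swap, intro sum.cong refl sum.swap)
  also have "\<dots> = (\<Sum>i\<le>d. \<Sum>j\<le>d. smult [:\<Sum>k<K. c k i * c k j:] (Q i j))"
  proof (intro sum.cong refl)
    fix i j
    show "(\<Sum>k<K. smult [:c k i * c k j:] (Q i j)) = smult [:\<Sum>k<K. c k i * c k j:] (Q i j)"
      by (induction K) (simp_all add: smult_add_left[symmetric])
  qed
  finally have "(\<Sum>i\<le>d. \<Sum>j\<le>d. smult [:\<Sum>k<K. c k i * c k j:] (Q i j)) = (\<Sum>j\<le>d. (newton_term M X \<eta> d j)\<^sup>2)"
    using eq by simp
  also have "\<dots> = (\<Sum>i\<le>d. \<Sum>j\<le>d. smult [:if i = j then 1 else 0:] (Q i j))"
  proof (intro sum.cong refl)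
    fix i assume "i \<in> {..d}"
    then have "(\<Sum>j\<le>d. if i = j then Q i j else 0) = Q i i"
      by simp
    moreover have "smult [:if i = j then 1 else 0:] (Q i j) = (if i = j then Q i j else 0)" for j
      by (simp flip: one_pCons)
    ultimately show "(newton_term M X \<eta> d i)\<^sup>2 = (\<Sum>j\<le>d. smult [:if i = j then 1 else 0:] (Q i j))"
      by (simp add: q Q_def power2_eq_square)
  qed
  moreover have "smult [:G i j:] (Q i j) =
      smult [:\<Sum>k<K. c k i * c k j:] (Q i j) - smult [:if i = j then 1 else 0:] (Q i j)" for i j
    by (simp add: G_def flip: smult_diff_left)
  ultimately have "(\<Sum>i\<le>d. \<Sum>j\<le>d. smult [:G i j:] (Q i j)) = 0"
    by (simp only: sum_subtractf diff_self)
  then have "(\<Sum>i\<le>d. \<Sum>j\<le>d. smult (smult (G i j) (\<alpha> i * \<alpha> j)) (B i * B j)) = 0"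
    by (simp add: Q_def)
  moreover have "\<forall>j\<le>d. a j = 0" if "(\<Sum>j\<le>d. smult (a j) (\<alpha> j)) = 0" for a
  proof (intro allI impI)
    fix j assume "j \<le> d"
    show "a j = 0"
    proof (rule distinct_degrees_independent[OF that _ _ \<open>j \<le> d\<close>])
      show "degree (\<alpha> j) < degree (\<alpha> i)" if "i < j" "j \<le> d" for i j
        using that \<open>M > 0\<close> by (simp add: \<alpha>_def degree_prod_linear)
      show "\<alpha> j \<noteq> 0" for j
        by (simp add: \<alpha>_def)
    qed
  qed
  moreover have "G i j = G j i" for i j
    by (simp add: G_def mult.commute)
  ultimately have "G i j = 0" if "i \<le> d" "j \<le> d" for i j
    using newton_products_independent[where \<eta> = \<eta> and d = d and \<alpha> = \<alpha> and G = G and i = i and j = j] that \<open>inj \<eta>\<close> unfolding B_def by blast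
  then show "(\<Sum>k<K. c k i * c k j) = (if i = j then 1 else 0)" if "i \<le> d" "j \<le> d" for i j
    using that by (simp add: G_def)
qed

text \<open>\<open>F S\<close> stands for the product \<open>f\<^sub>S\<close> and \<open>T\<close>
  for the empty index set. The \<open>q j\<close> are fixed before \<open>K\<close> and
  \<open>u\<close>, so one sum of squares rules out all short representations.\<close>

lemma long_sum_of_squares:
  fixes F :: "'s \<Rightarrow> real poly poly" and d :: nat
  assumes fin: "finite I" and T: "T \<in> I" "F T = 1"
    and pos: "\<And>S. S \<in> I \<Longrightarrow> lead_coeff (lead_coeff (F S)) > 0"
    and nonconst: "\<And>S. S \<in> I \<Longrightarrow> S \<noteq> T \<Longrightarrow> degree (F S) > 0 \<or> degree (lead_coeff (F S)) > 0"
  obtains q :: "nat \<Rightarrow> real poly poly" where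
    "\<And>K u. (\<Sum>j\<le>d. (q j)\<^sup>2) = (\<Sum>k<K. \<Sum>S\<in>I. F S * (u k S)\<^sup>2) \<Longrightarrow> d < K"
proof -
  have "\<forall>S. \<exists>C. \<forall>M>C. \<forall>c. c \<noteq> 0 \<longrightarrow>
      degree (poly (F S) (monom c M)) = M * degree (F S) + degree (lead_coeff (F S)) \<and>
      lead_coeff (poly (F S) (monom c M)) = lead_coeff (lead_coeff (F S)) * c ^ degree (F S)"
    by (metis lead_coeff_poly_monom)
  then obtain C where C: "\<And>S M c. C S < M \<Longrightarrow> c \<noteq> 0 \<Longrightarrow>
      degree (poly (F S) (monom c M)) = M * degree (F S) + degree (lead_coeff (F S)) \<and>
      lead_coeff (poly (F S) (monom c M)) = lead_coeff (lead_coeff (F S)) * c ^ degree (F S)"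
    by metis
  \<comment> \<open>One weight above all the thresholds \<open>C S\<close>; the successor makes the
    inequality strict and \<open>M\<close> positive.\<close>
  define M where "M = Suc (\<Sum>S\<in>I. C S)"
  have "M > 0"
    by (simp add: M_def)
  have "C S < M" if "S \<in> I" for S
    unfolding M_def using fin that by (intro le_imp_less_Suc member_le_sum) auto
  note C = C[OF this]
  have curve_lead: "lead_coeff (poly (F S) (monom c M)) > 0" if "S \<in> I" "c > 0" for S c
  proof -
    have "lead_coeff (poly (F S) (monom c M)) = lead_coeff (lead_coeff (F S)) * c ^ degree (F S)"
      using C[of S c] that by blast
    also have "\<dots> > 0"
      using pos that by simp
    finally show ?thesis .
  qed
  have curve_degree: "degree (poly (F S) (monom c M)) > 0" if "S \<in> I" "S \<noteq> T" "c > 0" for S c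
    using C[of S c] nonconst[of S] \<open>M > 0\<close> that by auto

  \<comment> \<open>The abscissas are chosen first. Only finitely many of them,
    \<open>s < M * d\<close>, occur in the grid, so a single \<open>y0\<close> then serves all of
    them and all \<open>S\<close>.\<close>
  let ?pos = "\<lambda>S x y. poly (poly (F S) [:y:]) x > 0"
  have "eventually (\<lambda>x. \<forall>S\<in>I. eventually (?pos S x) at_top) at_top"
    using fin pos eventually_eval_pos by (intro eventually_ball_finite) auto
  then obtain x0 where x0: "\<And>x S. x \<ge> x0 \<Longrightarrow> S \<in> I \<Longrightarrow> eventually (?pos S x) at_top"
    by (auto simp: eventually_at_top_linorder)
  define X where "X s = x0 + real s" for s
  have "eventually (\<lambda>y. \<forall>(S, s)\<in>I \<times> {..<M * d}. ?pos S (X s) y) at_top"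
    using fin x0 by (intro eventually_ball_finite) (auto simp: X_def)
  then obtain y0 where y0: "\<And>y S s. y \<ge> y0 \<Longrightarrow> S \<in> I \<Longrightarrow> s < M * d \<Longrightarrow> ?pos S (X s) y"
    by (auto simp: eventually_at_top_linorder)
  define \<eta> where "\<eta> t = y0 + real t" for t
  have inj: "inj X" "inj \<eta>"
    by (auto simp: inj_def X_def \<eta>_def)

  let ?q = "newton_term M X \<eta> d"
  show thesis
  proof (rule that[of ?q])
    fix K and u :: "nat \<Rightarrow> 's \<Rightarrow> real poly poly"
    assume eq: "(\<Sum>j\<le>d. (?q j)\<^sup>2) = (\<Sum>k<K. \<Sum>S\<in>I. F S * (u k S)\<^sup>2)"
    let ?I = "{..<K} \<times> I"
    have eq': "(\<Sum>j\<le>d. (?q j)\<^sup>2) = (\<Sum>(k, S)\<in>?I. F S * (u k S)\<^sup>2)"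
      by (simp add: eq sum.cartesian_product)

    \<comment> \<open>At a grid point the left side is 0 and the right side is a sum of nonnegative
      terms, so each term is 0, while its factor \<open>F S\<close> is positive.\<close>
    have vanish: "poly (poly (u k S) [:\<eta> t:]) (X s) = 0"
      if "k < K" "S \<in> I" "t < d" "s < M * (d - t)" for k S t s
    proof -
      have "s < M * d"
        by (rule less_le_trans[OF that(4)]) simp
      then have F: "poly (poly (F S) [:\<eta> t:]) (X s) > 0" if "S \<in> I" for S
        using y0[of "\<eta> t" S s] that by (simp add: \<eta>_def)
      let ?e = "\<lambda>p. poly (poly p [:\<eta> t:]) (X s)"
      have "(\<Sum>(k, S)\<in>?I. ?e (F S) * (?e (u k S))\<^sup>2) = (\<Sum>j\<le>d. (?e (?q j))\<^sup>2)"
        using arg_cong[OF eq', of ?e] by (simp add: poly_sum case_prod_unfold)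
      also have "\<dots> = 0"
        using that by (simp add: newton_term_vanishes)
      finally have "(\<Sum>(k, S)\<in>?I. ?e (F S) * (?e (u k S))\<^sup>2) = 0" .
      moreover have "case z of (k, S) \<Rightarrow> ?e (F S) * (?e (u k S))\<^sup>2 \<ge> 0" if "z \<in> ?I" for z
        using F that by (auto simp: less_imp_le)
      ultimately have "\<forall>z\<in>?I. (case z of (k, S) \<Rightarrow> ?e (F S) * (?e (u k S))\<^sup>2) = 0"
        using fin by (subst (asm) sum_nonneg_eq_0_iff) auto
      then have "?e (F S) * (?e (u k S))\<^sup>2 = 0"
        using that(1,2) by (auto dest!: bspec[of _ _ "(k, S)"])
      then show ?thesis
        using F[OF \<open>S \<in> I\<close>] by simp
    qed

    \<comment> \<open>Without cancellation no summand has larger degree than the left side. The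
      restriction of \<open>u k S\<close> has to be nonzero: otherwise its summand is 0 and says
      nothing about the degree of \<open>F S\<close>.\<close>
    have curve: "2 * degree (poly (u k S) (monom c M)) + degree (poly (F S) (monom c M)) \<le> 2 * (M * d)"
      if "k < K" "S \<in> I" "c > 0" "poly (u k S) (monom c M) \<noteq> 0" for k S c
    proof -
      let ?e = "\<lambda>p. poly p (monom c M)"
      let ?p = "\<lambda>(k, S). ?e (F S) * (?e (u k S))\<^sup>2"
      have "lead_coeff (?p z) \<ge> 0" if "z \<in> ?I" for z
        using that curve_lead[OF _ \<open>c > 0\<close>]
        by (auto simp: lead_coeff_mult lead_coeff_power less_imp_le)
      then have "degree (?p (k, S)) \<le> degree (\<Sum>z\<in>?I. ?p z)"
        using fin that by (intro degree_le_degree_sum) auto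
      also have "(\<Sum>z\<in>?I. ?p z) = (\<Sum>j\<le>d. (?e (?q j))\<^sup>2)"
        using arg_cong[OF eq', of ?e] by (simp add: poly_sum case_prod_unfold)
      also have "degree \<dots> \<le> 2 * (M * d)"
      proof (rule degree_sum_le)
        fix j assume "j \<in> {..d}"
        then have "degree (?e (?q j)) \<le> M * d"
          using degree_newton_term_poly_monom[of M X \<eta> d j c] by (simp flip: add_mult_distrib2)
        then show "degree ((?e (?q j))\<^sup>2) \<le> 2 * (M * d)"
          using degree_power_le[of "?e (?q j)" 2] by linarith
      qed simp
      also have "degree (?p (k, S)) = degree (?e (F S)) + 2 * degree (?e (u k S))"
        using that curve_lead[of S c] by (subst prod.case, subst degree_mult_eq) (auto simp: degree_power_eq)
      finally show ?thesis by simp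
    qed

    \<comment> \<open>Here \<open>F S\<close> contributes a positive degree on the curve, so the
      weighted degree of \<open>u k S\<close> is below \<open>M * d\<close> and the uniqueness half
      of the interpolation applies.\<close>
    have "u k S = 0" if "k < K" "S \<in> I" "S \<noteq> T" for k S
    proof -
      have "coeff (coeff (u k S) j) a = 0" if "M * d \<le> a + M * j" for a j
      proof (rule coeff_eq_0_if_poly_monom)
        fix c :: real assume "c > 0"
        then show "coeff (poly (u k S) (monom c M)) (a + M * j) = 0"
          using curve[of k S c] curve_degree[of S c] that \<open>k < K\<close> \<open>S \<in> I\<close> \<open>S \<noteq> T\<close>
          by (cases "poly (u k S) (monom c M) = 0") (auto intro!: coeff_eq_0)
      qed
      then show ?thesis
        using newton_interpolation[OF inj(1) \<open>M > 0\<close> inj(2), of d "u k S"] vanish[of k S] that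
        by auto
    qed
    then have "F S * (u k S)\<^sup>2 = (if S = T then (u k T)\<^sup>2 else 0)" if "k < K" "S \<in> I" for k S
      using that T(2) by auto
    then have eq0: "(\<Sum>j\<le>d. (?q j)\<^sup>2) = (\<Sum>k<K. (u k T)\<^sup>2)"
      using fin T(1) by (simp add: eq)
    \<comment> \<open>For \<open>T\<close> the degree bound is only weak, which is what the spanning
      half of the interpolation asks for.\<close>
    have "\<exists>c. u k T = (\<Sum>j\<le>d. smult [:c j:] (?q j))" if "k < K" for k
    proof -
      have "coeff (coeff (u k T) j) a = 0" if "M * d < a + M * j" for a j
      proof (rule coeff_eq_0_if_poly_monom)
        fix c :: real assume "c > 0"
        then show "coeff (poly (u k T) (monom c M)) (a + M * j) = 0"
          using curve[of k T c] that \<open>k < K\<close> T(1)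
          by (cases "poly (u k T) (monom c M) = 0") (auto intro!: coeff_eq_0)
      qed
      then show ?thesis
        using newton_interpolation[OF inj(1) \<open>M > 0\<close> inj(2), of d "u k T"] vanish[of k T] that T(1)
        by auto
    qed
    then obtain c where c: "\<And>k. k < K \<Longrightarrow> u k T = (\<Sum>j\<le>d. smult [:c k j:] (?q j))"
      by metis
    show "d < K"
      by (rule sum_squares_newton_terms[OF \<open>M > 0\<close> inj(2), where d = d and X = X and K = K and c = c]) (simp add: eq0 c)
  qed
qed

section \<open>Components with respect to the square roots\<close>

definition odd_vars :: "nat \<Rightarrow> (nat \<Rightarrow>\<^sub>0 nat) \<Rightarrow> nat set" where
  "odd_vars n m = {i \<in> {1..n}. odd (Poly_Mapping.lookup m i)}"

definition half_power :: "nat \<Rightarrow> (nat \<Rightarrow> real_poly_xy) \<Rightarrow> (nat \<Rightarrow>\<^sub>0 nat) \<Rightarrow> real_poly_xy" where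
  "half_power n f m = (\<Prod>i\<in>{1..n}. f i ^ (Poly_Mapping.lookup m i div 2))"

text \<open>
  The coefficient of \<open>\<Prod>\<^bsub>i \<in> S\<^esub> \<surd>f\<^sub>i\<close> after reducing a representative \<open>p\<close> by \<open>z\<^sub>i\<^sup>2 = f\<^sub>i\<close>: a monomial
  \<open>m\<close> contributes \<open>f\<^sub>i\<close> to the power \<open>m\<^sub>i div 2\<close> and leaves \<open>z\<^sub>i\<close> exactly for the odd exponents \<open>m\<^sub>i\<close>.
\<close>
definition sqrt_coeff :: "nat \<Rightarrow> (nat \<Rightarrow> real_poly_xy) \<Rightarrow> nat set \<Rightarrow> zpoly \<Rightarrow> real_poly_xy" where
  "sqrt_coeff n f S p =
     (\<Sum>m\<in>Poly_Mapping.keys p.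
        if odd_vars n m = S then Poly_Mapping.lookup p m * half_power n f m else 0)"

text \<open>Cancellation can shrink the keys of a sum; summing over a common finite superset makes
  additivity a termwise statement.\<close>

lemma sqrt_coeff_superset:
  assumes "finite A" "Poly_Mapping.keys p \<subseteq> A"
  shows "sqrt_coeff n f S p =
     (\<Sum>m\<in>A. if odd_vars n m = S then Poly_Mapping.lookup p m * half_power n f m else 0)"
  unfolding sqrt_coeff_def using assms
  by (intro sum.mono_neutral_left) (auto simp: in_keys_iff)

lemma sqrt_coeff_add: "sqrt_coeff n f S (p + q) = sqrt_coeff n f S p + sqrt_coeff n f S q"
proof -
  let ?A = "Poly_Mapping.keys p \<union> Poly_Mapping.keys q"
  show ?thesis
    using Poly_Mapping.keys_add[of p q]
    by (simp add: sqrt_coeff_superset[of ?A] lookup_add distrib_right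
        flip: sum.distrib cong: if_cong) (intro sum.cong refl, simp)
qed

lemma sqrt_coeff_zero [simp]: "sqrt_coeff n f S 0 = 0"
  by (simp add: sqrt_coeff_def)

lemma sqrt_coeff_diff: "sqrt_coeff n f S (p - q) = sqrt_coeff n f S p - sqrt_coeff n f S q"
  using sqrt_coeff_add[of n f S "p - q" q] by simp

lemma sqrt_coeff_sum: "sqrt_coeff n f S (\<Sum>a\<in>A. p a) = (\<Sum>a\<in>A. sqrt_coeff n f S (p a))"
  by (induction A rule: infinite_finite_induct) (simp_all add: sqrt_coeff_add)

lemma sqrt_coeff_single:
  "sqrt_coeff n f S (Poly_Mapping.single m c) = (if odd_vars n m = S then c * half_power n f m else 0)"
  by (subst sqrt_coeff_superset[of "{m}"]) auto

lemma poly_mapping_sum_single: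
  "p = (\<Sum>m\<in>Poly_Mapping.keys p. Poly_Mapping.single m (Poly_Mapping.lookup p m))"
proof (rule poly_mapping_eqI)
  fix k
  have "(\<Sum>m\<in>Poly_Mapping.keys p. Poly_Mapping.lookup p m when m = k) =
      (\<Sum>m\<in>Poly_Mapping.keys p. if m = k then Poly_Mapping.lookup p k else 0)"
    by (intro sum.cong) (auto simp: when_def)
  then show "Poly_Mapping.lookup p k =
      Poly_Mapping.lookup (\<Sum>m\<in>Poly_Mapping.keys p. Poly_Mapping.single m (Poly_Mapping.lookup p m)) k"
    by (simp add: lookup_sum lookup_single in_keys_iff)
qed

lemma half_power_add_2:
  assumes "i \<in> {1..n}"
  shows "half_power n f (m + Poly_Mapping.single i 2) = half_power n f m * f i"
proof -
  have "half_power n f (m + Poly_Mapping.single i 2) =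
      (\<Prod>j\<in>{1..n}. f j ^ (Poly_Mapping.lookup m j div 2) * (if j = i then f i else 1))"
    unfolding half_power_def by (intro prod.cong) (auto simp: lookup_add lookup_single when_def)
  also have "\<dots> = half_power n f m * f i"
    using assms by (simp add: prod.distrib half_power_def)
  finally show ?thesis .
qed

lemma odd_vars_add_2: "odd_vars n (m + Poly_Mapping.single i 2) = odd_vars n m"
  by (auto simp: odd_vars_def lookup_add lookup_single when_def)

text \<open>Multiplying a monomial by the square of the \<open>i\<close>-th variable keeps all
  parities and adds one factor \<open>f i\<close> to \<open>half_power\<close>, exactly as
  multiplication by \<open>f i\<close> does. Additivity extends this from monomials to
  \<open>q\<close>.\<close>

lemma sqrt_coeff_relation:
  assumes "i \<in> {1..n}"
  shows "sqrt_coeff n f S (q * (zpoly_var i ^ 2 - zpoly_const (f i))) = 0"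
proof -
  have sq: "zpoly_var i ^ 2 = Poly_Mapping.single (Poly_Mapping.single i 2) 1"
    by (simp add: zpoly_var_def power2_eq_square mult_single numeral_2_eq_2 flip: single_add)
  have "sqrt_coeff n f S (Poly_Mapping.single m c * (zpoly_var i ^ 2 - zpoly_const (f i))) = 0" for m c
    using half_power_add_2[OF assms, of f m]
    by (simp add: sq zpoly_const_def right_diff_distrib mult_single sqrt_coeff_diff
        sqrt_coeff_single odd_vars_add_2 mult_ac)
  then have "sqrt_coeff n f S ((\<Sum>m\<in>Poly_Mapping.keys q. Poly_Mapping.single m (Poly_Mapping.lookup q m))
      * (zpoly_var i ^ 2 - zpoly_const (f i))) = 0"
    by (simp only: sum_distrib_right sqrt_coeff_sum sum.neutral_const)
  then show ?thesis
    by (simp only: flip: poly_mapping_sum_single)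
qed

text \<open>This makes the components well defined on residue classes. Since
  \<open>sqrt_coeff\<close> is additive but not multiplicative, its kernel is replaced by the set
  \<open>?J\<close> of elements all of whose multiples it kills; \<open>?J\<close> is an ideal
  containing the generators.\<close>

lemma sqrt_coeff_sqrt_ideal:
  assumes "p \<in> sqrt_ideal n f"
  shows "sqrt_coeff n f S p = 0"
proof -
  let ?R = "zpoly_ring n"
  let ?J = "{p \<in> carrier ?R. \<forall>q. sqrt_coeff n f S (q * p) = 0}"
  interpret cring ?R
    by (rule cring_zpoly_ring)
  have minus: "\<ominus>\<^bsub>?R\<^esub> x = - x" if "x \<in> carrier ?R" for x
    using that by (intro minus_equality) (simp_all add: zpoly_ring_simps zpoly_carrier_uminus)
  have "ideal ?J ?R"
  proof (rule idealI[OF ring_axioms])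
    show "subgroup ?J (add_monoid ?R)"
    proof (rule subgroup.intro)
      fix x assume x: "x \<in> ?J"
      then have "inv\<^bsub>add_monoid ?R\<^esub> x = - x"
        using minus[of x] by (simp add: a_inv_def)
      then show "inv\<^bsub>add_monoid ?R\<^esub> x \<in> ?J"
        using x sqrt_coeff_diff[of n f S 0] by (simp add: zpoly_carrier_uminus)
    qed (auto simp: zpoly_ring_simps zpoly_carrier_add zpoly_carrier_0 distrib_left sqrt_coeff_add)
  next
    fix a x assume ax: "a \<in> ?J" "x \<in> carrier ?R"
    then have "sqrt_coeff n f S (q * (x * a)) = 0" for q
      by (simp flip: mult.assoc)
    then show "x \<otimes>\<^bsub>?R\<^esub> a \<in> ?J" "a \<otimes>\<^bsub>?R\<^esub> x \<in> ?J"
      using ax by (simp_all add: zpoly_ring_simps zpoly_carrier_mult mult.commute[of a])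
  qed
  moreover have "(\<lambda>i. zpoly_var i ^ 2 - zpoly_const (f i)) ` {1..n} \<subseteq> ?J"
    using zpoly_generators_carrier sqrt_coeff_relation by blast
  ultimately have "sqrt_ideal n f \<subseteq> ?J"
    unfolding sqrt_ideal_def by (rule genideal_minimal)
  then have "sqrt_coeff n f S (1 * p) = 0"
    using assms by blast
  then show ?thesis by simp
qed

text \<open>Two odd exponents of the same variable leave a remainder 1 each, and together these
  yield one more factor \<open>f i\<close>.\<close>

lemma half_power_add:
  assumes "odd_vars n m = odd_vars n m'"
  shows "half_power n f (m + m') = half_power n f m * half_power n f m' * (\<Prod>i\<in>odd_vars n m. f i)"
proof -
  have "half_power n f (m + m') = (\<Prod>i\<in>{1..n}. f i ^ (Poly_Mapping.lookup m i div 2) *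
      f i ^ (Poly_Mapping.lookup m' i div 2) * (if i \<in> odd_vars n m then f i else 1))"
    unfolding half_power_def
  proof (intro prod.cong refl)
    fix i assume i: "i \<in> {1..n}"
    have "odd (Poly_Mapping.lookup m i) \<longleftrightarrow> odd (Poly_Mapping.lookup m' i)"
      using assms i by (auto simp: odd_vars_def set_eq_iff)
    moreover have "(a + b) div 2 = a div 2 + b div 2 + (if odd a then 1 else 0)"
      if "odd a \<longleftrightarrow> odd b" for a b :: nat
      using that by (cases "even a") (auto elim!: evenE oddE)
    ultimately have "Poly_Mapping.lookup (m + m') i div 2 = Poly_Mapping.lookup m i div 2 +
        Poly_Mapping.lookup m' i div 2 + (if i \<in> odd_vars n m then 1 else 0)"
      using i by (simp add: lookup_add odd_vars_def)
    then show "f i ^ (Poly_Mapping.lookup (m + m') i div 2) = f i ^ (Poly_Mapping.lookup m i div 2) *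
        f i ^ (Poly_Mapping.lookup m' i div 2) * (if i \<in> odd_vars n m then f i else 1)"
      by (simp add: power_add)
  qed
  also have "\<dots> = half_power n f m * half_power n f m' * (\<Prod>i\<in>{1..n} \<inter> odd_vars n m. f i)"
    by (simp add: prod.distrib half_power_def prod.inter_restrict)
  also have "{1..n} \<inter> odd_vars n m = odd_vars n m"
    by (auto simp: odd_vars_def)
  finally show ?thesis .
qed

lemma odd_vars_add_eq_empty: "odd_vars n (m + m') = {} \<longleftrightarrow> odd_vars n m = odd_vars n m'"
  by (auto simp: odd_vars_def lookup_add)

text \<open>A product of two monomials has no odd variable only if both have the same odd variables
  \<open>S\<close>. Grouping the pairs by \<open>S\<close> gives one square for each
  \<open>S\<close>, multiplied by \<open>f\<^sub>S\<close>.\<close>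

lemma sqrt_coeff_square:
  "sqrt_coeff n f {} (p ^ 2) = (\<Sum>S\<in>Pow {1..n}. (\<Prod>i\<in>S. f i) * (sqrt_coeff n f S p)\<^sup>2)"
proof -
  let ?K = "Poly_Mapping.keys p"
  define c where "c m = Poly_Mapping.lookup p m * half_power n f m" for m
  have p2: "p ^ 2 = (\<Sum>m\<in>?K. \<Sum>m'\<in>?K.
      Poly_Mapping.single (m + m') (Poly_Mapping.lookup p m * Poly_Mapping.lookup p m'))"
    by (subst (1) poly_mapping_sum_single[of p])
      (simp only: power2_eq_square sum_product mult_single)
  have "sqrt_coeff n f {} (p ^ 2) = (\<Sum>m\<in>?K. \<Sum>m'\<in>?K.
      if odd_vars n m = odd_vars n m' then c m * c m' * (\<Prod>i\<in>odd_vars n m. f i) else 0)"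
    unfolding p2 sqrt_coeff_sum sqrt_coeff_single odd_vars_add_eq_empty
    by (intro sum.cong refl) (simp add: half_power_add c_def mult_ac)
  \<comment> \<open>The inner sum over \<open>S\<close> has a single possibly nonzero term, at
    \<open>S = odd_vars n m\<close>; it is inserted so that \<open>S\<close> can be moved
    outermost.\<close>
  also have "\<dots> = (\<Sum>m\<in>?K. \<Sum>m'\<in>?K. \<Sum>S\<in>Pow {1..n}.
      if S = odd_vars n m then if odd_vars n m' = S then c m * c m' * (\<Prod>i\<in>S. f i) else 0 else 0)"
    by (intro sum.cong refl) (auto simp: odd_vars_def)
  also have "\<dots> = (\<Sum>m\<in>?K. \<Sum>S\<in>Pow {1..n}. \<Sum>m'\<in>?K.
      if S = odd_vars n m then if odd_vars n m' = S then c m * c m' * (\<Prod>i\<in>S. f i) else 0 else 0)"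
    by (intro sum.cong refl sum.swap)
  also have "\<dots> = (\<Sum>S\<in>Pow {1..n}. \<Sum>m\<in>?K. \<Sum>m'\<in>?K.
      if S = odd_vars n m then if odd_vars n m' = S then c m * c m' * (\<Prod>i\<in>S. f i) else 0 else 0)"
    by (rule sum.swap)
  also have "\<dots> = (\<Sum>S\<in>Pow {1..n}. (\<Prod>i\<in>S. f i) * (sqrt_coeff n f S p)\<^sup>2)"
    unfolding sqrt_coeff_def power2_eq_square c_def[symmetric] unfolding sum_product
    unfolding sum_distrib_left
    by (intro sum.cong refl) (auto simp: mult_ac)
  finally show ?thesis .
qed

section \<open>Sums of squares in the quotient ring\<close>

lemma carrier_sqrt_ring:
  "carrier (sqrt_ring n f) =
     (\<lambda>p. sqrt_ideal n f +>\<^bsub>zpoly_ring n\<^esub> p) ` carrier (zpoly_ring n)"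
  by (auto simp: sqrt_ring_def FactRing_def A_RCOSETS_def')

text \<open>The quotient map is a surjective ring homomorphism, so sums of squares of cosets can be
  read as congruences between representatives.\<close>

lemma is_sum_of_n_squares_sqrt_ring_iff:
  assumes p: "p \<in> carrier (zpoly_ring n)"
  shows "is_sum_of_n_squares (sqrt_ring n f) k (sqrt_ideal n f +>\<^bsub>zpoly_ring n\<^esub> p) \<longleftrightarrow>
    (\<exists>h \<in> {..<k} \<rightarrow> carrier (zpoly_ring n). p - (\<Sum>i<k. (h i)\<^sup>2) \<in> sqrt_ideal n f)"
proof -
  let ?R = "zpoly_ring n" and ?I = "sqrt_ideal n f"
  let ?\<phi> = "(+>\<^bsub>?R\<^esub>) ?I"
  interpret R: cring ?R
    by (rule cring_zpoly_ring)
  interpret Q: cring "sqrt_ring n f"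
    by (rule cring_sqrt_ring)
  interpret \<phi>: ring_hom_cring ?R "sqrt_ring n f" ?\<phi>
    unfolding sqrt_ring_def by (rule ideal.rcos_ring_hom_cring[OF ideal_sqrt_ideal cring_zpoly_ring])
  have square: "x ^ 2 \<in> carrier ?R" "?\<phi> (x ^ 2) = ?\<phi> x [^]\<^bsub>sqrt_ring n f\<^esub> (2::nat)"
    if "x \<in> carrier ?R" for x
  proof -
    show "x ^ 2 \<in> carrier ?R"
      using that by (simp add: power2_eq_square zpoly_carrier_mult)
    have "?\<phi> (x \<otimes>\<^bsub>?R\<^esub> x) = ?\<phi> x \<otimes>\<^bsub>sqrt_ring n f\<^esub> ?\<phi> x"
      by (intro \<phi>.hom_mult that)
    then show "?\<phi> (x ^ 2) = ?\<phi> x [^]\<^bsub>sqrt_ring n f\<^esub> (2::nat)"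
      using that by (simp add: numeral_2_eq_2 zpoly_ring_simps)
  qed
  have sum: "(\<Sum>i<k. (h i)\<^sup>2) \<in> carrier ?R \<and>
      ?\<phi> (\<Sum>i<k. (h i)\<^sup>2) = (\<Oplus>\<^bsub>sqrt_ring n f\<^esub>i\<in>{..<k}. ?\<phi> (h i) [^]\<^bsub>sqrt_ring n f\<^esub> (2::nat))"
    if "h \<in> {..<k} \<rightarrow> carrier ?R" for h :: "nat \<Rightarrow> zpoly" and k
    using that
  proof (induction k)
    case 0
    show ?case
      using \<phi>.hom_zero by (simp add: zpoly_carrier_0 zpoly_ring_simps)
  next
    case (Suc k)
    have h: "h \<in> {..<k} \<rightarrow> carrier ?R" "h k \<in> carrier ?R"
      using Suc.prems by auto
    note IH = Suc.IH[OF h(1)]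
    have "?\<phi> ((\<Sum>i<k. (h i)\<^sup>2) \<oplus>\<^bsub>?R\<^esub> (h k)\<^sup>2) =
        ?\<phi> (\<Sum>i<k. (h i)\<^sup>2) \<oplus>\<^bsub>sqrt_ring n f\<^esub> ?\<phi> ((h k)\<^sup>2)"
      using IH square(1)[OF h(2)] by (intro \<phi>.hom_add) auto
    also have "\<dots> = ?\<phi> ((h k)\<^sup>2) \<oplus>\<^bsub>sqrt_ring n f\<^esub> ?\<phi> (\<Sum>i<k. (h i)\<^sup>2)"
      using IH square(1)[OF h(2)] by (intro Q.a_comm \<phi>.hom_closed) auto
    also have "\<dots> = ?\<phi> (h k) [^]\<^bsub>sqrt_ring n f\<^esub> (2::nat) \<oplus>\<^bsub>sqrt_ring n f\<^esub>
        (\<Oplus>\<^bsub>sqrt_ring n f\<^esub>i\<in>{..<k}. ?\<phi> (h i) [^]\<^bsub>sqrt_ring n f\<^esub> (2::nat))"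
      by (simp only: IH square(2)[OF h(2)])
    also have "\<dots> = (\<Oplus>\<^bsub>sqrt_ring n f\<^esub>i\<in>{..<Suc k}. ?\<phi> (h i) [^]\<^bsub>sqrt_ring n f\<^esub> (2::nat))"
      unfolding lessThan_Suc using h
      by (intro Q.finsum_insert[symmetric]) (auto intro!: Q.nat_pow_closed \<phi>.hom_closed)
    finally show ?case
      using IH square(1)[OF h(2)] by (simp add: zpoly_ring_simps zpoly_carrier_add)
  qed
  have eq_iff: "?\<phi> p = ?\<phi> x \<longleftrightarrow> p - x \<in> ?I" if x: "x \<in> carrier ?R" for x
  proof -
    have "\<ominus>\<^bsub>?R\<^esub> x = - x"
      using x by (intro R.minus_equality) (simp_all add: zpoly_ring_simps zpoly_carrier_uminus)
    then show ?thesis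
      using R.quotient_eq_iff_same_a_r_cos[OF ideal_sqrt_ideal p x, of f]
      by (simp add: a_minus_def zpoly_ring_simps)
  qed
  note carrier = carrier_sqrt_ring[of n f]
  show ?thesis
  proof
    assume "is_sum_of_n_squares (sqrt_ring n f) k (?\<phi> p)"
    then obtain g where g: "g \<in> {..<k} \<rightarrow> ?\<phi> ` carrier ?R"
      "?\<phi> p = (\<Oplus>\<^bsub>sqrt_ring n f\<^esub>i\<in>{..<k}. g i [^]\<^bsub>sqrt_ring n f\<^esub> (2::nat))"
      by (auto simp: is_sum_of_n_squares_def carrier)
    then have "\<forall>i\<in>{..<k}. \<exists>x. x \<in> carrier ?R \<and> g i = ?\<phi> x"
      by blast
    then obtain h where h: "\<And>i. i < k \<Longrightarrow> h i \<in> carrier ?R \<and> g i = ?\<phi> (h i)"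
      by (metis lessThan_iff)
    then have "?\<phi> p = (\<Oplus>\<^bsub>sqrt_ring n f\<^esub>i\<in>{..<k}. ?\<phi> (h i) [^]\<^bsub>sqrt_ring n f\<^esub> (2::nat))"
      unfolding g(2) by (intro Q.finsum_cong') auto
    moreover have hc: "h \<in> {..<k} \<rightarrow> carrier ?R"
      using h by blast
    ultimately have "?\<phi> p = ?\<phi> (\<Sum>i<k. (h i)\<^sup>2)"
      using sum[OF hc] by simp
    then have "p - (\<Sum>i<k. (h i)\<^sup>2) \<in> ?I"
      using sum[OF hc] eq_iff by blast
    with hc show "\<exists>h \<in> {..<k} \<rightarrow> carrier ?R. p - (\<Sum>i<k. (h i)\<^sup>2) \<in> ?I"
      by blast
  next
    assume "\<exists>h \<in> {..<k} \<rightarrow> carrier ?R. p - (\<Sum>i<k. (h i)\<^sup>2) \<in> ?I"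
    then obtain h where h: "h \<in> {..<k} \<rightarrow> carrier ?R" "p - (\<Sum>i<k. (h i)\<^sup>2) \<in> ?I"
      by blast
    then show "is_sum_of_n_squares (sqrt_ring n f) k (?\<phi> p)"
      using sum[OF h(1)] eq_iff unfolding is_sum_of_n_squares_def carrier
      by (intro bexI[of _ "\<lambda>i. ?\<phi> (h i)"]) auto
  qed
qed

section \<open>Constants, products of leading coefficients and the Pythagoras number\<close>

lemma zpoly_const_carrier: "zpoly_const c \<in> carrier (zpoly_ring n)"
  by (auto simp: zpoly_ring_def zpoly_const_def)

lemma zpoly_carrier_sum:
  assumes "\<And>a. a \<in> A \<Longrightarrow> p a \<in> carrier (zpoly_ring n)"
  shows "(\<Sum>a\<in>A. p a) \<in> carrier (zpoly_ring n)"
  using assms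
  by (induction A rule: infinite_finite_induct) (simp_all add: zpoly_carrier_0 zpoly_carrier_add)

lemma sqrt_coeff_const_square: "sqrt_coeff n f {} ((zpoly_const c)\<^sup>2) = c\<^sup>2"
  by (simp add: zpoly_const_def power2_eq_square mult_single sqrt_coeff_single odd_vars_def half_power_def)

lemma lead_coeff_lead_coeff_prod:
  fixes f :: "'b \<Rightarrow> 'a::idom poly poly"
  shows "lead_coeff (lead_coeff (\<Prod>i\<in>S. f i)) = (\<Prod>i\<in>S. lead_coeff (lead_coeff (f i)))"
  by (induction S rule: infinite_finite_induct) (simp_all add: lead_coeff_mult)

text \<open>Used contrapositively: a product \<open>f\<^sub>S\<close> that is not a square but has
  positive y-leading coefficient cannot be constant.\<close>

lemma pos_constant_is_square:
  fixes p :: "real poly poly"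
  assumes "degree p = 0" "degree (lead_coeff p) = 0" "lead_coeff (lead_coeff p) > 0"
  shows "\<exists>h. p = h\<^sup>2"
proof -
  obtain a where "p = [:a:]"
    using assms(1) by (rule degree_eq_zeroE)
  moreover from this assms(2) obtain b where "a = [:b:]"
    by (auto elim: degree_eq_zeroE)
  ultimately show ?thesis
    using assms(3) by (intro exI[of _ "[:[:sqrt b:]:]"]) (simp add: power2_eq_square)
qed

theorem theorem2p3:
  fixes n :: nat and f :: "nat \<Rightarrow> real_poly_xy"
  assumes "square_independent n f"
    and "\<exists>a b. \<forall>i\<in>{1..n}. eval_xy (f i) a b = 0"
    and "\<forall>i\<in>{1..n}. y_lead_coeff (f i) > 0"
  shows "p\<^sub>2 (sqrt_ring n f) = \<infinity>"
proof -
  let ?R = "zpoly_ring n" and ?I = "sqrt_ideal n f"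
  have "\<not> pythagoras_bound (sqrt_ring n f) g" for g
  proof
    assume bound: "pythagoras_bound (sqrt_ring n f) g"
    let ?F = "\<lambda>S. \<Prod>i\<in>S. f i"
    have pos: "lead_coeff (lead_coeff (?F S)) > 0" if "S \<in> Pow {1..n}" for S
      unfolding lead_coeff_lead_coeff_prod
      using assms(3) that by (intro prod_pos) (auto simp: y_lead_coeff_def)
    have "degree (?F S) > 0 \<or> degree (lead_coeff (?F S)) > 0"
      if "S \<in> Pow {1..n}" "S \<noteq> {}" for S
      using pos_constant_is_square[of "?F S"] pos[of S] assms(1) that
      unfolding square_independent_def by blast
    then obtain q :: "nat \<Rightarrow> real_poly_xy" where q:
      "\<And>K u. (\<Sum>j\<le>g. (q j)\<^sup>2) = (\<Sum>k<K. \<Sum>S\<in>Pow {1..n}. ?F S * (u k S)\<^sup>2) \<Longrightarrow> g < K"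
      using long_sum_of_squares[where I = "Pow {1..n}" and T = "{}" and F = ?F and d = g] pos
      by auto
    \<comment> \<open>With \<open>d = g\<close> there are \<open>g + 1\<close> squares, which no
      \<open>K \<le> g\<close> squares can replace.\<close>
    define p where "p = (\<Sum>j<Suc g. (zpoly_const (q j))\<^sup>2)"
    have "p \<in> carrier ?R"
      unfolding p_def power2_eq_square
      by (intro zpoly_carrier_sum zpoly_carrier_mult zpoly_const_carrier)
    note sos_iff = is_sum_of_n_squares_sqrt_ring_iff[OF this, of f]
    have "is_sum_of_n_squares (sqrt_ring n f) (Suc g) (?I +>\<^bsub>?R\<^esub> p)"
      unfolding sos_iff
    proof (rule bexI[of _ "\<lambda>j. zpoly_const (q j)"])
      have "\<zero>\<^bsub>?R\<^esub> \<in> ?I"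
        using ideal_sqrt_ideal by (intro additive_subgroup.zero_closed ideal.axioms(1))
      then show "p - (\<Sum>i<Suc g. (zpoly_const (q i))\<^sup>2) \<in> ?I"
        by (simp add: p_def zpoly_ring_simps)
    qed (simp add: zpoly_const_carrier)
    moreover have "?I +>\<^bsub>?R\<^esub> p \<in> carrier (sqrt_ring n f)"
      using \<open>p \<in> carrier ?R\<close> by (simp add: carrier_sqrt_ring)
    ultimately obtain K where K: "K \<le> g" "is_sum_of_n_squares (sqrt_ring n f) K (?I +>\<^bsub>?R\<^esub> p)"
      using bound unfolding pythagoras_bound_def by blast
    then obtain h where "p - (\<Sum>i<K. (h i)\<^sup>2) \<in> ?I"
      unfolding sos_iff by blast
    \<comment> \<open>The congruence modulo the ideal becomes an equality in \<real>[x,y] between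
      the components without square roots.\<close>
    from sqrt_coeff_sqrt_ideal[OF this, of "{}"]
    have "sqrt_coeff n f {} p = sqrt_coeff n f {} (\<Sum>i<K. (h i)\<^sup>2)"
      by (simp add: sqrt_coeff_diff)
    moreover have "sqrt_coeff n f {} p = (\<Sum>j\<le>g. (q j)\<^sup>2)"
      by (simp only: p_def sqrt_coeff_sum sqrt_coeff_const_square lessThan_Suc_atMost)
    ultimately have "(\<Sum>j\<le>g. (q j)\<^sup>2) =
        (\<Sum>k<K. \<Sum>S\<in>Pow {1..n}. ?F S * (sqrt_coeff n f S (h k))\<^sup>2)"
      by (simp only: sqrt_coeff_sum sqrt_coeff_square)
    then have "g < K"
      by (rule q)
    with K(1) show False by simp
  qed
  then show ?thesis
    by (simp add: pythagoras_number_def)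
qed

end
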